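(* Let $n\ge2$ and $\tau_i=(c_i,d_i,p_i,J_i)$, $i=1,\dots,n$, nonnegative integers with $c_i\ge1$, $p_i\ge1$, $c_i\le d_i\le p_i$, $0\le J_i\le p_i$, $\sum_{i<n}c_i/p_i<1$ and $\sum_{i\le n}c_i/p_i\le1$; let $p_{\max}=\max_{i\le n}p_i$ and $r_n=\min\{t\in\mathbb{Z}_{\ge0}: t\ge c_n+\sum_{i<n}c_i\lceil (t+J_i)/p_i\rceil\}$. For an integer $k$ let \[ \mathcal{M}(k)=\min\Big\{s+\sum_{i<n}c_ix_i : s+p_ix_i\ge k+J_i\ \forall i<n,\ s\in\mathbb{Z}_{\ge0},\ x\in\mathbb{Z}^{n-1}\Big\}. \] Let $S$ be a global upper bound on the value of $s$ in any optimal solution $(s,x)$ of $\mathcal{M}(k)$ (over all $k$), and suppose $\mathcal{M}(k)$ can be computed in time at most $T_{\mathcal{M}}$ for every $k$. Then $r_n$ can be computed in time $O(\max(Sn,\,T_{\mathcal{M}}\log p_{\max}))$, which is at most $O(Sn\log p_{\max})$.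
   Context: Running times count arithmetic operations on numbers from the input. *)

theory Defs
  imports Complex_Main
begin

section \<open>A unit-cost integer RAM\<close>

text \<open>
  Running times count operations on integers. Programs are syntactic objects, so a running time is
  attached to a concrete finite program and not to a HOL function. The state is an
  integer-addressed memory (with indirect addressing); the input is a read-only list.
  Every evaluated node of an expression (arithmetic operation, memory or input access, constant)
  and every executed command costs one time unit.
\<close>

datatype expr =
    Const int
  | Mem expr
  | Inp expr
  | Add expr expr
  | Sub expr expr
  | Mul expr expr
  | Div expr expr

type_synonym mem = "int \<Rightarrow> int"

text \<open>Input positions count from 0, and reading outside the input yields 0. Division is the
  floor division of \<^typ>\<open>int\<close>.\<close>

fun eval :: "int list \<Rightarrow> mem \<Rightarrow> expr \<Rightarrow> int" where
  "eval inp m (Const a) = a"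
| "eval inp m (Mem e) = m (eval inp m e)"
| "eval inp m (Inp e) =
     (let i = eval inp m e in if 0 \<le> i \<and> i < int (length inp) then inp ! nat i else 0)"
| "eval inp m (Add e f) = eval inp m e + eval inp m f"
| "eval inp m (Sub e f) = eval inp m e - eval inp m f"
| "eval inp m (Mul e f) = eval inp m e * eval inp m f"
| "eval inp m (Div e f) = eval inp m e div eval inp m f"

fun cost :: "expr \<Rightarrow> nat" where
  "cost (Const a) = 1"
| "cost (Mem e) = cost e + 1"
| "cost (Inp e) = cost e + 1"
| "cost (Add e f) = cost e + cost f + 1"
| "cost (Sub e f) = cost e + cost f + 1"
| "cost (Mul e f) = cost e + cost f + 1"
| "cost (Div e f) = cost e + cost f + 1"

datatype prog =
    Skip
  | Store expr expr
  | Seq prog prog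
  | Cond expr prog prog
  | While expr prog
  | Call expr prog expr

definition init_mem :: "int \<Rightarrow> mem" where
  "init_mem a = (\<lambda>_. 0)(0 := a)"

text \<open>
  \<open>exec inp P m t m'\<close>: on input \<open>inp\<close>, program \<open>P\<close> started in memory \<open>m\<close> halts after
  \<open>t\<close> time units in memory \<open>m'\<close>. Tests succeed if the value is positive.
  \<open>Call a P e\<close> runs \<open>P\<close> as a subroutine in a fresh memory of its own, with the value of \<open>e\<close>
  as argument in cell 0, and stores its result (the final content of its cell 0) at address \<open>a\<close>;
  it costs the running time of \<open>P\<close> in addition to the call itself.
\<close>

inductive exec :: "int list \<Rightarrow> prog \<Rightarrow> mem \<Rightarrow> nat \<Rightarrow> mem \<Rightarrow> bool" for inp where
  Skip: "exec inp Skip m 1 m"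
| Store: "exec inp (Store a e) m (1 + cost a + cost e) (m(eval inp m a := eval inp m e))"
| Seq: "exec inp P m t m' \<Longrightarrow> exec inp Q m' u m'' \<Longrightarrow> exec inp (Seq P Q) m (t + u) m''"
| CondTrue: "eval inp m e > 0 \<Longrightarrow> exec inp P m t m' \<Longrightarrow>
    exec inp (Cond e P Q) m (1 + cost e + t) m'"
| CondFalse: "\<not> eval inp m e > 0 \<Longrightarrow> exec inp Q m t m' \<Longrightarrow>
    exec inp (Cond e P Q) m (1 + cost e + t) m'"
| WhileTrue: "eval inp m e > 0 \<Longrightarrow> exec inp P m t m' \<Longrightarrow> exec inp (While e P) m' u m'' \<Longrightarrow>
    exec inp (While e P) m (1 + cost e + t + u) m''"
| WhileFalse: "\<not> eval inp m e > 0 \<Longrightarrow> exec inp (While e P) m (1 + cost e) m"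
| Call: "exec inp P (init_mem (eval inp m e)) t m' \<Longrightarrow>
    exec inp (Call a P e) m (1 + cost a + cost e + t) (m(eval inp m a := m' 0))"

lemma exec_deterministic:
  assumes "exec inp P m t m'" and "exec inp P m u m''"
  shows "t = u \<and> m' = m''"
  using assms
proof (induction arbitrary: u m'' rule: exec.induct)
  case Skip
  then show ?case by (auto elim: exec.cases)
next
  case Store
  from Store.prems show ?case by cases auto
next
  case Seq
  from Seq.prems show ?case by cases (use Seq.IH in blast)
next
  case CondTrue
  from CondTrue.prems show ?case by cases (use CondTrue.IH CondTrue.hyps in blast)+
next
  case CondFalse
  from CondFalse.prems show ?case by cases (use CondFalse.IH CondFalse.hyps in blast)+
next
  case WhileTrue
  from WhileTrue.prems show ?case by cases (use WhileTrue.IH WhileTrue.hyps in blast)+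
next
  case WhileFalse
  from WhileFalse.prems show ?case by cases (use WhileFalse.hyps in blast)+
next
  case Call
  from Call.prems show ?case by cases (use Call.IH in blast)
qed

definition computes_within :: "real \<Rightarrow> prog \<Rightarrow> int list \<Rightarrow> int \<Rightarrow> int \<Rightarrow> bool" where
  "computes_within T P inp a v \<longleftrightarrow>
     (\<exists>t m. exec inp P (init_mem a) t m \<and> real t \<le> T \<and> m 0 = v)"


section \<open>Tasks, response time and the mixing-set problem\<close>

text \<open>Task \<open>i\<close> is \<open>(c i, d i, p i, J i)\<close> for \<open>i \<in> {1..n}\<close>; values at other indices are irrelevant.\<close>

definition task_system ::
  "nat \<Rightarrow> (nat \<Rightarrow> nat) \<Rightarrow> (nat \<Rightarrow> nat) \<Rightarrow> (nat \<Rightarrow> nat) \<Rightarrow> (nat \<Rightarrow> nat) \<Rightarrow> bool" where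
  "task_system n c d p J \<longleftrightarrow>
     n \<ge> 2 \<and>
     (\<forall>i\<in>{1..n}. c i \<ge> 1 \<and> p i \<ge> 1 \<and> c i \<le> d i \<and> d i \<le> p i \<and> J i \<le> p i) \<and>
     (\<Sum>i\<in>{1..<n}. real (c i) / real (p i)) < 1 \<and>
     (\<Sum>i\<in>{1..n}. real (c i) / real (p i)) \<le> 1"

definition p_max :: "nat \<Rightarrow> (nat \<Rightarrow> nat) \<Rightarrow> nat" where
  "p_max n p = Max (p ` {1..n})"

definition response_time :: "nat \<Rightarrow> (nat \<Rightarrow> nat) \<Rightarrow> (nat \<Rightarrow> nat) \<Rightarrow> (nat \<Rightarrow> nat) \<Rightarrow> nat" where
  "response_time n c p J =
     (LEAST t::nat. int t \<ge> int (c n) +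
        (\<Sum>i\<in>{1..<n}. int (c i) * \<lceil>(real t + real (J i)) / real (p i)\<rceil>))"

definition mix_feasible ::
  "nat \<Rightarrow> (nat \<Rightarrow> nat) \<Rightarrow> (nat \<Rightarrow> nat) \<Rightarrow> int \<Rightarrow> nat \<times> (nat \<Rightarrow> int) \<Rightarrow> bool" where
  "mix_feasible n p J k = (\<lambda>(s, x). \<forall>i\<in>{1..<n}. int s + int (p i) * x i \<ge> k + int (J i))"

definition mix_objective :: "nat \<Rightarrow> (nat \<Rightarrow> nat) \<Rightarrow> nat \<times> (nat \<Rightarrow> int) \<Rightarrow> int" where
  "mix_objective n c = (\<lambda>(s, x). int s + (\<Sum>i\<in>{1..<n}. int (c i) * x i))"

definition mix_min ::
  "nat \<Rightarrow> (nat \<Rightarrow> nat) \<Rightarrow> (nat \<Rightarrow> nat) \<Rightarrow> (nat \<Rightarrow> nat) \<Rightarrow> int \<Rightarrow> int" where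
  "mix_min n c p J k = (LEAST v. \<exists>y. mix_feasible n p J k y \<and> v = mix_objective n c y)"

text \<open>\<open>S\<close> bounds \<open>s\<close> in every optimal solution, for every \<open>k\<close>. For a task system this forces
  \<open>S \<ge> 1\<close>: all periods below \<open>n\<close> are at least 2, and if \<open>k + J 1 \<equiv> 1 (mod p 1)\<close> then replacing
  \<open>s = 0\<close> by \<open>s = 1\<close> lowers \<open>x 1\<close> by one, so \<open>s = 0\<close> is not the only optimal choice.
  Hence \<open>S * n\<close> and \<open>log 2 (p_max n p)\<close> are at least 1.\<close>

definition slack_bound ::
  "nat \<Rightarrow> (nat \<Rightarrow> nat) \<Rightarrow> (nat \<Rightarrow> nat) \<Rightarrow> (nat \<Rightarrow> nat) \<Rightarrow> nat \<Rightarrow> bool" where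
  "slack_bound n c p J S \<longleftrightarrow>
     (\<forall>k s x. is_arg_min (mix_objective n c) (mix_feasible n p J k) (s, x) \<longrightarrow> s \<le> S)"

definition encode ::
  "nat \<Rightarrow> (nat \<Rightarrow> nat) \<Rightarrow> (nat \<Rightarrow> nat) \<Rightarrow> (nat \<Rightarrow> nat) \<Rightarrow> (nat \<Rightarrow> nat) \<Rightarrow> nat \<Rightarrow> int list" where
  "encode n c d p J S =
     int n # int S # concat (map (\<lambda>i. [int (c i), int (d i), int (p i), int (J i)]) [1..<Suc n])"

definition computes_mix_min ::
  "real \<Rightarrow> prog \<Rightarrow> nat \<Rightarrow> (nat \<Rightarrow> nat) \<Rightarrow> (nat \<Rightarrow> nat) \<Rightarrow> (nat \<Rightarrow> nat) \<Rightarrow> (nat \<Rightarrow> nat) \<Rightarrow> nat \<Rightarrow> bool"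
where
  "computes_mix_min T P n c d p J S \<longleftrightarrow>
     (\<forall>k. computes_within T P (encode n c d p J S) k (mix_min n c p J k))"

definition computes_response_time ::
  "real \<Rightarrow> prog \<Rightarrow> nat \<Rightarrow> (nat \<Rightarrow> nat) \<Rightarrow> (nat \<Rightarrow> nat) \<Rightarrow> (nat \<Rightarrow> nat) \<Rightarrow> (nat \<Rightarrow> nat) \<Rightarrow> nat \<Rightarrow> bool"
where
  "computes_response_time T P n c d p J S \<longleftrightarrow>
     computes_within T P (encode n c d p J S) 0 (int (response_time n c p J))"

end

theory Submission
  imports Defs
begin

text \<open>
  Put \<open>g t = t - (\<Sum>i<n. c i * \<lceil>(t + J i) / p i\<rceil>)\<close>. For fixed \<open>s\<close> the best \<open>x\<close> in the mixing
  set is obtained by rounding up, with objective \<open>k - g (k - s)\<close>; hence \<open>k - M k\<close> is the maximum of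
  \<open>g\<close> on \<open>(-\<infinity>, k]\<close>. Since \<open>g\<close> is nonpositive on \<open>(-\<infinity>, 0]\<close>, the response time is the least \<open>k\<close>
  with \<open>k - M k \<ge> c n\<close>, a condition monotone in \<open>k\<close>. As \<open>g\<close> grows with slope at least
  \<open>c n / p n\<close> up to a bounded error, the response time is at most \<open>3 * p_max\<^sup>2\<close>, so that doubling and
  bisection find it with \<open>O(log p_max)\<close> evaluations of \<open>M\<close>. Finally, \<open>M k\<close> itself is the minimum of
  \<open>k - g (k - s)\<close> over \<open>0 \<le> s \<le> S\<close>, and each term takes time \<open>O(n)\<close>.
\<close>

section \<open>Time-bounded total correctness\<close>

text \<open>A weakest-precondition predicate with a time budget. Tracking only an upper bound on the
  time lets branches of different cost merge and lets the rules below build up the budget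
  schematically.\<close>

definition runs :: "int list \<Rightarrow> prog \<Rightarrow> mem \<Rightarrow> nat \<Rightarrow> (mem \<Rightarrow> bool) \<Rightarrow> bool" where
  "runs inp P m T Q \<longleftrightarrow> (\<exists>t m'. exec inp P m t m' \<and> t \<le> T \<and> Q m')"

lemma runs_mono:
  assumes "runs inp P m t Q" and "t \<le> T" and "\<And>m'. Q m' \<Longrightarrow> R m'"
  shows "runs inp P m T R"
  using assms unfolding runs_def by (meson order_trans)

lemma runs_weaken: "runs inp P m t Q \<Longrightarrow> t \<le> T \<Longrightarrow> runs inp P m T Q"
  by (rule runs_mono)

lemma runs_Skip: "Q m \<Longrightarrow> runs inp Skip m 1 Q"
  unfolding runs_def by (blast intro: exec.Skip)

lemma runs_Store:
  "Q (m(eval inp m a := eval inp m e)) \<Longrightarrow> runs inp (Store a e) m (1 + cost a + cost e) Q"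
  unfolding runs_def by (blast intro: exec.Store)

text \<open>The rest of the program sits in the postcondition, so no intermediate assertion has to
  be named and backward application amounts to symbolic execution.\<close>

lemma runs_Seq:
  assumes "runs inp P m t (\<lambda>m'. runs inp Q m' u R)"
  shows "runs inp (Seq P Q) m (t + u) R"
  using assms unfolding runs_def by (meson exec.Seq add_mono)

lemma runs_Cond:
  assumes "eval inp m e > 0 \<Longrightarrow> runs inp P m t R"
    and "\<not> eval inp m e > 0 \<Longrightarrow> runs inp Q m u R"
  shows "runs inp (Cond e P Q) m (1 + cost e + max t u) R"
proof (cases "eval inp m e > 0")
  case True
  with assms(1) obtain v m' where "exec inp P m v m'" "v \<le> t" "R m'"
    unfolding runs_def by blast
  moreover from exec.CondTrue[OF True this(1)]
  have "exec inp (Cond e P Q) m (1 + cost e + v) m'" .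
  ultimately show ?thesis
    unfolding runs_def by (intro exI[of _ "1 + cost e + v"] exI[of _ m']) auto
next
  case False
  with assms(2) obtain v m' where "exec inp Q m v m'" "v \<le> u" "R m'"
    unfolding runs_def by blast
  moreover from exec.CondFalse[OF False this(1)]
  have "exec inp (Cond e P Q) m (1 + cost e + v) m'" .
  ultimately show ?thesis
    unfolding runs_def by (intro exI[of _ "1 + cost e + v"] exI[of _ m']) auto
qed

lemma runs_Call:
  assumes "runs inp P (init_mem (eval inp m e)) t (\<lambda>m'. m' 0 = v)"
    and "Q (m(eval inp m a := v))"
  shows "runs inp (Call a P e) m (1 + cost a + cost e + t) Q"
proof -
  obtain u m' where "exec inp P (init_mem (eval inp m e)) u m'" "u \<le> t" "m' 0 = v"
    using assms(1) unfolding runs_def by blast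
  with assms(2) exec.Call[OF this(1), of a] show ?thesis
    unfolding runs_def by (metis add_left_mono)
qed

text \<open>The index of \<open>I\<close> is a countdown that bounds the remaining iterations: a
  successful test forces it to be a successor. The factor \<open>Suc i\<close> leaves room for the
  final failing test.\<close>

lemma runs_While:
  assumes "I i m"
    and step: "\<And>i m. I i m \<Longrightarrow> eval inp m e > 0 \<Longrightarrow> \<exists>j. i = Suc j \<and> runs inp P m t (I j)"
    and exit: "\<And>i m. I i m \<Longrightarrow> \<not> eval inp m e > 0 \<Longrightarrow> Q m"
  shows "runs inp (While e P) m (Suc i * (t + cost e + 1)) Q"
  using assms(1)
proof (induction i arbitrary: m rule: less_induct)
  case (less i)
  show ?case
  proof (cases "eval inp m e > 0")
    case True
    with step less.prems obtain j where j: "i = Suc j" "runs inp P m t (I j)"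
      by blast
    then obtain u m' where u: "exec inp P m u m'" "u \<le> t" "I j m'"
      unfolding runs_def by blast
    with less.IH[of j m'] j obtain v m'' where
      v: "exec inp (While e P) m' v m''" "v \<le> Suc j * (t + cost e + 1)" "Q m''"
      unfolding runs_def by blast
    have "1 + cost e + u + v \<le> Suc i * (t + cost e + 1)"
      using u(2) v(2) j(1) by simp
    with exec.WhileTrue[OF True u(1) v(1)] v(3) show ?thesis
      unfolding runs_def by blast
  next
    case False
    with exit less.prems have "Q m" by blast
    moreover have "1 + cost e \<le> Suc i * (t + cost e + 1)" by simp
    ultimately show ?thesis
      unfolding runs_def using exec.WhileFalse[of inp m e, OF False] by blast
  qed
qed

text \<open>Forces every valid time bound of a subroutine to be at least 1, so that additive
  constants can be absorbed into it.\<close>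

lemma exec_time_pos: "exec inp P m t m' \<Longrightarrow> t \<ge> 1"
  by (induction rule: exec.induct) auto

lemma computes_within_iff_runs:
  "computes_within T P inp a v \<longleftrightarrow>
     T \<ge> 0 \<and> runs inp P (init_mem a) (nat \<lfloor>T\<rfloor>) (\<lambda>m. m 0 = v)"
proof -
  have "real t \<le> T \<longleftrightarrow> T \<ge> 0 \<and> t \<le> nat \<lfloor>T\<rfloor>" for t
    by (cases "T \<ge> 0") (auto simp: le_nat_floor nat_le_iff le_floor_iff zle_int le_nat_iff)
  then show ?thesis
    unfolding computes_within_def runs_def by blast
qed

lemma computes_within_runsI:
  assumes "runs inp P (init_mem a) t (\<lambda>m. m 0 = v)" and "real t \<le> T"
  shows "computes_within T P inp a v"
proof -
  obtain u m where "exec inp P (init_mem a) u m" "u \<le> t" "m 0 = v"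
    using assms(1) unfolding runs_def by blast
  with assms(2) show ?thesis
    unfolding computes_within_def by (intro exI[of _ u] exI[of _ m]) auto
qed


section \<open>Reading the input\<close>

lemma nth_concat_blocks:
  assumes "\<And>i. length (f i) = 4" and "i \<in> {1..n}" and "j < 4"
  shows "concat (map f [1..<Suc n]) ! (4 * (i - 1) + j) = f i ! j"
  using assms(2)
proof (induction n)
  case (Suc n)
  have len: "length (concat (map f [1..<Suc n])) = 4 * n" for n
    by (induction n) (auto simp: assms(1))
  have split: "concat (map f [1..<Suc (Suc n)]) = concat (map f [1..<Suc n]) @ f (Suc n)"
    by simp
  show ?case
  proof (cases "i = Suc n")
    case True
    then show ?thesis unfolding split nth_append len by simp
  next
    case False
    with Suc.prems have "4 * (i - 1) + j < 4 * n" "i \<in> {1..n}"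
      using assms(3) by auto
    with Suc.IH show ?thesis unfolding split nth_append len by simp
  qed
qed simp

lemma length_encode: "length (encode n c d p J S) = 4 * n + 2"
  unfolding encode_def by (induction n) auto

lemma encode_nth:
  assumes "i \<in> {1..n}" and "j < 4"
  shows "encode n c d p J S ! (4 * i - 2 + j) = [int (c i), int (d i), int (p i), int (J i)] ! j"
proof -
  have "4 * i - 2 + j = Suc (Suc (4 * (i - 1) + j))"
    using assms(1) by auto
  then show ?thesis
    unfolding encode_def using nth_concat_blocks[OF _ assms, of "\<lambda>i. [int (c i), int (d i), int (p i), int (J i)]"]
    by simp
qed

text \<open>After two header entries the block of task \<open>i\<close> occupies positions
  \<open>4 * i - 2\<close> to \<open>4 * i + 1\<close>. The address enters as a premise, which turns
  the facts into conditional rewrite rules for arbitrary address expressions.\<close>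

lemma eval_Inp_encode:
  assumes "i \<in> {1..n}"
  shows "eval inp m e = 4 * int i - 2 \<Longrightarrow> inp = encode n c d p J S \<Longrightarrow> eval inp m (Inp e) = int (c i)"
    and "eval inp m e = 4 * int i \<Longrightarrow> inp = encode n c d p J S \<Longrightarrow> eval inp m (Inp e) = int (p i)"
    and "eval inp m e = 4 * int i + 1 \<Longrightarrow> inp = encode n c d p J S \<Longrightarrow> eval inp m (Inp e) = int (J i)"
proof -
  have "nat (4 * int i - 2) = 4 * i - 2 + 0" "nat (4 * int i) = 4 * i - 2 + 2"
    "nat (4 * int i + 1) = 4 * i - 2 + 3"
    using assms by auto
  with assms encode_nth[OF assms, of 0] encode_nth[OF assms, of 2] encode_nth[OF assms, of 3]
  show "eval inp m e = 4 * int i - 2 \<Longrightarrow> inp = encode n c d p J S \<Longrightarrow> eval inp m (Inp e) = int (c i)"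
    and "eval inp m e = 4 * int i \<Longrightarrow> inp = encode n c d p J S \<Longrightarrow> eval inp m (Inp e) = int (p i)"
    and "eval inp m e = 4 * int i + 1 \<Longrightarrow> inp = encode n c d p J S \<Longrightarrow> eval inp m (Inp e) = int (J i)"
    by (auto simp: length_encode Let_def)
qed

lemma eval_Inp_encode_header:
  "eval (encode n c d p J S) m (Inp (Const 0)) = int n"
  "eval (encode n c d p J S) m (Inp (Const 1)) = int S"
  by (auto simp: encode_def)


section \<open>The mixing set and the response time\<close>

text \<open>Written with floor division, the only division of the machine, so that it matches what
  the programs evaluate.\<close>

definition ceil_div :: "int \<Rightarrow> int \<Rightarrow> int" where
  "ceil_div a b = - (- a div b)"

lemma ceil_div_eq_ceiling: "ceil_div a b = \<lceil>real_of_int a / real_of_int b\<rceil>"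
  unfolding ceil_div_def ceiling_divide_eq_div ..

text \<open>The Galois connection between rounding up and multiplication; it yields both feasibility
  and minimality of the rounded \<open>x\<close>.\<close>

lemma ceil_div_le_iff:
  assumes "b > 0"
  shows "ceil_div a b \<le> x \<longleftrightarrow> a \<le> b * x"
proof -
  have "ceil_div a b \<le> x \<longleftrightarrow> real_of_int a \<le> real_of_int (b * x)"
    unfolding ceil_div_eq_ceiling ceiling_le_iff using assms by (simp add: field_simps)
  then show ?thesis by linarith
qed

lemma real_ceil_div:
  "real_of_int a / real_of_int b \<le> real_of_int (ceil_div a b)"
  "real_of_int (ceil_div a b) \<le> real_of_int a / real_of_int b + 1"
  unfolding ceil_div_eq_ceiling by linarith+

text \<open>Defined for all integers, negative ones included, because the slack \<open>s\<close> in
  \<open>k - s\<close> may exceed \<open>k\<close>.\<close>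

definition surplus :: "nat \<Rightarrow> (nat \<Rightarrow> nat) \<Rightarrow> (nat \<Rightarrow> nat) \<Rightarrow> (nat \<Rightarrow> nat) \<Rightarrow> int \<Rightarrow> int" where
  "surplus n c p J t = t - (\<Sum>i\<in>{1..<n}. int (c i) * ceil_div (t + int (J i)) (int (p i)))"

lemma response_time_surplus:
  "response_time n c p J = (LEAST t::nat. surplus n c p J (int t) \<ge> int (c n))"
proof -
  have "\<lceil>(real t + real (J i)) / real (p i)\<rceil> = ceil_div (int t + int (J i)) (int (p i))" for t i
    using ceiling_divide_eq_div[of "int t + int (J i)" "int (p i)"] by (simp add: ceil_div_def)
  then show ?thesis
    unfolding response_time_def surplus_def by (simp add: algebra_simps)
qed

locale tasks =
  fixes n :: nat and c d p J :: "nat \<Rightarrow> nat"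
  assumes system: "task_system n c d p J"
begin

abbreviation g :: "int \<Rightarrow> int" where "g \<equiv> surplus n c p J"
abbreviation M :: "int \<Rightarrow> int" where "M \<equiv> mix_min n c p J"

section \<open>Utilization and linear bounds on the surplus\<close>

definition util :: real where "util = (\<Sum>i\<in>{1..<n}. real (c i) / real (p i))"

lemma n_ge_2: "n \<ge> 2"
  using system unfolding task_system_def by blast

lemma task_bounds:
  assumes "i \<in> {1..n}"
  shows "c i \<ge> 1" "p i \<ge> 1" "J i \<le> p i" "p i \<le> p_max n p"
  using system assms unfolding task_system_def p_max_def by auto

lemma util_less_1: "util < 1"
  using system unfolding task_system_def util_def by blast

lemma util_le: "util + real (c n) / real (p n) \<le> 1"
proof -
  have "{1..n} = insert n {1..<n}" using n_ge_2 by auto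
  then show ?thesis using system unfolding task_system_def util_def by simp
qed

lemma p1_ge_2: "p 1 \<ge> 2"
proof -
  have "real (c 1) / real (p 1) \<le> util"
    unfolding util_def using n_ge_2 by (intro member_le_sum) auto
  with util_less_1 have "real (c 1) / real (p 1) < 1" by linarith
  with task_bounds[of 1] n_ge_2 show ?thesis by (cases "p 1 = 1") auto
qed

lemma p_max_ge_2: "p_max n p \<ge> 2"
  using p1_ge_2 task_bounds(4)[of 1] n_ge_2 by simp

lemma log_p_max_ge_1: "log 2 (real (p_max n p)) \<ge> 1"
  using p_max_ge_2 by (simp add: le_log_iff)

text \<open>Dropping the jitter and the rounding can only decrease the subtracted sum, which leaves
  \<open>util * t\<close>.\<close>

lemma surplus_le: "real_of_int (g t) \<le> (1 - util) * real_of_int t"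
proof -
  have "util * real_of_int t
      \<le> (\<Sum>i\<in>{1..<n}. real (c i) * real_of_int (ceil_div (t + int (J i)) (int (p i))))"
    unfolding util_def sum_distrib_right
  proof (rule sum_mono)
    fix i assume i: "i \<in> {1..<n}"
    then have p: "p i \<ge> 1" using task_bounds(2)[of i] by auto
    have "real_of_int t / real (p i) \<le> real_of_int (t + int (J i)) / real_of_int (int (p i))"
      by (simp add: divide_right_mono)
    also have "\<dots> \<le> real_of_int (ceil_div (t + int (J i)) (int (p i)))"
      by (rule real_ceil_div)
    finally have "real (c i) * (real_of_int t / real (p i))
        \<le> real (c i) * real_of_int (ceil_div (t + int (J i)) (int (p i)))"
      by (intro mult_left_mono) auto
    then show "real (c i) / real (p i) * real_of_int t
        \<le> real (c i) * real_of_int (ceil_div (t + int (J i)) (int (p i)))"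
      by simp
  qed
  then show ?thesis unfolding surplus_def by (simp add: algebra_simps)
qed

lemma surplus_less:
  assumes "t \<le> 0"
  shows "g t < int (c n)"
proof -
  have "(1 - util) * real_of_int t \<le> 0"
    using util_less_1 assms by (intro mult_nonneg_nonpos) auto
  with surplus_le[of t] task_bounds(1)[of n] n_ge_2 show ?thesis by simp
qed

text \<open>Each \<open>c i\<close> is at most its utilization times \<open>p_max\<close>, and the
  utilizations sum to less than 1.\<close>

lemma sum_costs_le: "(\<Sum>i\<in>{1..<n}. real (c i)) \<le> real (p_max n p)"
proof -
  have "(\<Sum>i\<in>{1..<n}. real (c i)) \<le> (\<Sum>i\<in>{1..<n}. real (c i) / real (p i) * real (p_max n p))"
  proof (rule sum_mono)
    fix i assume "i \<in> {1..<n}"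
    then have "p i \<ge> 1" "p i \<le> p_max n p" using task_bounds[of i] by auto
    then have "real (c i) * real (p i) \<le> real (c i) * real (p_max n p)" "real (p i) > 0"
      by (auto intro: mult_left_mono)
    then show "real (c i) \<le> real (c i) / real (p i) * real (p_max n p)"
      by (simp add: field_simps)
  qed
  also have "\<dots> = util * real (p_max n p)"
    unfolding util_def sum_distrib_right ..
  also have "\<dots> \<le> 1 * real (p_max n p)"
    using util_less_1 by (intro mult_right_mono) auto
  finally show ?thesis by simp
qed

text \<open>For each task rounding adds at most 1 and jitter at most
  \<open>J i / p i \<le> 1\<close> to the quotient, so the total error is at most twice the sum of
  the costs.\<close>

lemma surplus_ge: "real_of_int (g t) \<ge> (1 - util) * real_of_int t - 2 * real (p_max n p)"
proof -
  have "(\<Sum>i\<in>{1..<n}. real (c i) * real_of_int (ceil_div (t + int (J i)) (int (p i))))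
      \<le> (\<Sum>i\<in>{1..<n}. real (c i) / real (p i) * real_of_int t + 2 * real (c i))"
  proof (rule sum_mono)
    fix i assume i: "i \<in> {1..<n}"
    then have p: "p i \<ge> 1" "J i \<le> p i" using task_bounds[of i] by auto
    then have "real (J i) / real (p i) \<le> 1" by simp
    moreover have "real_of_int (ceil_div (t + int (J i)) (int (p i)))
        \<le> real_of_int (t + int (J i)) / real_of_int (int (p i)) + 1"
      by (rule real_ceil_div)
    ultimately have "real_of_int (ceil_div (t + int (J i)) (int (p i)))
        \<le> real_of_int t / real (p i) + 2"
      by (simp add: add_divide_distrib)
    then have "real (c i) * real_of_int (ceil_div (t + int (J i)) (int (p i)))
        \<le> real (c i) * (real_of_int t / real (p i) + 2)"
      by (intro mult_left_mono) auto
    then show "real (c i) * real_of_int (ceil_div (t + int (J i)) (int (p i)))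
        \<le> real (c i) / real (p i) * real_of_int t + 2 * real (c i)"
      by (simp add: algebra_simps)
  qed
  also have "\<dots> = util * real_of_int t + 2 * (\<Sum>i\<in>{1..<n}. real (c i))"
    by (simp add: util_def sum.distrib sum_distrib_right sum_distrib_left)
  also have "\<dots> \<le> util * real_of_int t + 2 * real (p_max n p)"
    using sum_costs_le by simp
  finally show ?thesis unfolding surplus_def by (simp add: algebra_simps)
qed

text \<open>With \<open>P = p_max\<close>, the slope \<open>1 - util\<close> is at least
  \<open>c n / P\<close>, so the linear term at \<open>3 * P\<^sup>2\<close> is at least
  \<open>3 * c n * P\<close>. Subtracting the error \<open>2 * P\<close> leaves at least
  \<open>c n * P\<close>.\<close>

lemma surplus_at_bound: "g (int (3 * (p_max n p)\<^sup>2)) \<ge> int (c n)"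
proof -
  let ?P = "real (p_max n p)"
  have cp: "c n \<ge> 1" "p n \<ge> 1" "p n \<le> p_max n p"
    using task_bounds[of n] n_ge_2 by auto
  have "real (c n) / ?P \<le> real (c n) / real (p n)"
    using cp by (intro divide_left_mono) auto
  also have "\<dots> \<le> 1 - util" using util_le by linarith
  finally have "real (c n) / ?P * (3 * ?P\<^sup>2) \<le> (1 - util) * (3 * ?P\<^sup>2)"
    by (intro mult_right_mono) auto
  moreover have "real (c n) / ?P * (3 * ?P\<^sup>2) = 3 * (real (c n) * ?P)"
    using p_max_ge_2 by (simp add: power2_eq_square)
  moreover have "?P \<le> real (c n) * ?P" "real (c n) \<le> real (c n) * ?P"
    using cp p_max_ge_2 by (auto simp: mult_le_cancel_left1 mult_le_cancel_right1)
  moreover have "(1 - util) * (3 * ?P\<^sup>2) - 2 * ?P \<le> real_of_int (g (int (3 * (p_max n p)\<^sup>2)))"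
    using surplus_ge[of "int (3 * (p_max n p)\<^sup>2)"] by simp
  ultimately have "real (c n) \<le> real_of_int (g (int (3 * (p_max n p)\<^sup>2)))"
    by linarith
  then show ?thesis by linarith
qed

section \<open>The response time as a threshold\<close>

lemma response_time_le: "response_time n c p J \<le> 3 * (p_max n p)\<^sup>2"
  unfolding response_time_surplus by (rule Least_le) (rule surplus_at_bound)

text \<open>A witness \<open>t\<close> cannot be negative by \<open>surplus_less\<close>, so
  minimising over the naturals agrees with minimising over the integers.\<close>

lemma response_time_le_iff:
  "int (response_time n c p J) \<le> k \<longleftrightarrow> (\<exists>t\<le>k. int (c n) \<le> g t)"
proof
  have "int (c n) \<le> g (int (response_time n c p J))"
    unfolding response_time_surplus by (rule LeastI) (rule surplus_at_bound)
  then show "int (response_time n c p J) \<le> k \<Longrightarrow> \<exists>t\<le>k. int (c n) \<le> g t"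
    by blast
next
  assume "\<exists>t\<le>k. int (c n) \<le> g t"
  then obtain t where t: "t \<le> k" "int (c n) \<le> g t" by blast
  have "t \<ge> 0"
    using surplus_less[of t] t(2) by linarith
  then have "response_time n c p J \<le> nat t"
    unfolding response_time_surplus using t(2) by (intro Least_le) simp
  with t(1) \<open>t \<ge> 0\<close> show "int (response_time n c p J) \<le> k" by linarith
qed

section \<open>Optimal solutions of the mixing set\<close>

definition best_x :: "int \<Rightarrow> nat \<Rightarrow> nat \<Rightarrow> int" where
  "best_x k s i = ceil_div (k - int s + int (J i)) (int (p i))"

lemma best_x_feasible: "mix_feasible n p J k (s, best_x k s)"
proof -
  have "k - int s + int (J i) \<le> int (p i) * best_x k s i" if "i \<in> {1..<n}" for i
    using ceil_div_le_iff[of "int (p i)" "k - int s + int (J i)" "best_x k s i"]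
      task_bounds(2)[of i] that
    unfolding best_x_def by auto
  then show ?thesis unfolding mix_feasible_def by fastforce
qed

lemma best_x_objective: "mix_objective n c (s, best_x k s) = k - g (k - int s)"
  unfolding mix_objective_def surplus_def best_x_def by simp

text \<open>For fixed \<open>s\<close>, rounding up gives the componentwise least feasible
  \<open>x\<close>, and all costs are nonnegative.\<close>

lemma objective_ge:
  assumes "mix_feasible n p J k (s, x)"
  shows "k - g (k - int s) \<le> mix_objective n c (s, x)"
proof -
  have "best_x k s i \<le> x i" if "i \<in> {1..<n}" for i
    using ceil_div_le_iff[of "int (p i)" "k - int s + int (J i)" "x i"]
      task_bounds(2)[of i] that assms
    unfolding best_x_def mix_feasible_def by fastforce
  then have "(\<Sum>i\<in>{1..<n}. int (c i) * best_x k s i) \<le> (\<Sum>i\<in>{1..<n}. int (c i) * x i)"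
    by (intro sum_mono mult_left_mono) auto
  with best_x_objective[of s k] show ?thesis
    unfolding mix_objective_def by simp
qed

text \<open>Infinitely many slacks compete, but the linear upper bound caps the integer values of
  \<open>g\<close> on them, so a maximum is attained.\<close>

lemma best_slack_exists: "\<exists>s0. \<forall>s. g (k - int s) \<le> g (k - int s0)"
proof -
  define B where "B = \<lceil>(1 - util) * real_of_int k\<rceil>"
  have B: "g (k - int s) \<le> B" for s
  proof -
    have "(1 - util) * real_of_int (k - int s) \<le> (1 - util) * real_of_int k"
      using util_less_1 by (intro mult_left_mono) auto
    with surplus_le[of "k - int s"] show ?thesis unfolding B_def by linarith
  qed
  \<comment> \<open>Since \<open>B\<close> caps all values, \<open>nat\<close> loses nothing, and a
    least gap to \<open>B\<close> is a largest value of \<open>g\<close>.\<close>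
  obtain s0 where "\<forall>s. nat (B - g (k - int s0)) \<le> nat (B - g (k - int s))"
    using ex_has_least_nat[of "\<lambda>_. True" "0::nat" "\<lambda>s. nat (B - g (k - int s))"] by auto
  with B have "g (k - int s) \<le> g (k - int s0)" for s
    by (smt (verit) nat_le_eq_zle)
  then show ?thesis by blast
qed

text \<open>The attained value meets the lower bound over all feasible points. Optimality of the
  pair, and not only its value, is recorded because \<open>slack_bound\<close> speaks about optimal
  solutions.\<close>

lemma best_slack_optimal:
  assumes "\<forall>s. g (k - int s) \<le> g (k - int s0)"
  shows "is_arg_min (mix_objective n c) (mix_feasible n p J k) (s0, best_x k s0)"
    and "M k = k - g (k - int s0)"
proof -
  have ge: "k - g (k - int s0) \<le> mix_objective n c y" if "mix_feasible n p J k y" for y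
    using objective_ge[of k "fst y" "snd y"] that assms[rule_format, of "fst y"] by simp
  then show "is_arg_min (mix_objective n c) (mix_feasible n p J k) (s0, best_x k s0)"
    unfolding is_arg_min_def using best_x_feasible best_x_objective by (metis not_le)
  show "M k = k - g (k - int s0)"
    unfolding mix_min_def
    by (rule Least_equality) (use ge best_x_feasible best_x_objective in metis)+
qed

text \<open>This is the comparison that drives both search loops: one evaluation of \<open>M\<close>
  decides on which side of \<open>k\<close> the response time lies.\<close>

lemma response_time_le_iff_mix_min:
  "int (response_time n c p J) \<le> k \<longleftrightarrow> int (c n) \<le> k - M k"
proof -
  obtain s0 where s0: "\<forall>s. g (k - int s) \<le> g (k - int s0)"
    using best_slack_exists by blast
  have "(\<exists>t\<le>k. int (c n) \<le> g t) \<longleftrightarrow> int (c n) \<le> g (k - int s0)"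
  proof
    assume "\<exists>t\<le>k. int (c n) \<le> g t"
    then obtain t where t: "t \<le> k" "int (c n) \<le> g t" by blast
    then show "int (c n) \<le> g (k - int s0)"
      using s0[rule_format, of "nat (k - t)"] by simp
  qed (auto intro: exI[of _ "k - int s0"])
  then show ?thesis
    using response_time_le_iff best_slack_optimal(2)[OF s0] by simp
qed

text \<open>Some maximising slack is part of an optimal solution and hence at most \<open>S\<close>,
  which cuts the search over \<open>s\<close> down to a finite range.\<close>

lemma mix_min_eq_Min:
  assumes "slack_bound n c p J S"
  shows "M k = (MIN s\<in>{0..int S}. k - g (k - s))"
proof -
  obtain s0 where s0: "\<forall>s. g (k - int s) \<le> g (k - int s0)"
    using best_slack_exists by blast
  have "s0 \<le> S"
    using best_slack_optimal(1)[OF s0] assms unfolding slack_bound_def by blast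
  have "(MIN s\<in>{0..int S}. k - g (k - s)) = k - g (k - int s0)"
  proof (rule Min_eqI)
    fix y assume "y \<in> (\<lambda>s. k - g (k - s)) ` {0..int S}"
    then obtain s where "y = k - g (k - s)" "s \<ge> 0" by auto
    then show "k - g (k - int s0) \<le> y" using s0[rule_format, of "nat s"] by simp
  qed (use \<open>s0 \<le> S\<close> in auto)
  with best_slack_optimal(2)[OF s0] show ?thesis by simp
qed

text \<open>At \<open>k = 1 - J 1\<close>, raising \<open>s\<close> from 0 to 1 lowers \<open>x 1\<close>, so \<open>s = 0\<close> is never the only optimum.\<close>

lemma slack_bound_pos:
  assumes "slack_bound n c p J S"
  shows "S \<ge> 1"
proof (rule ccontr)
  assume "\<not> S \<ge> 1"
  define k where "k = 1 - int (J 1)"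
  obtain s0 where s0: "\<forall>s. g (k - int s) \<le> g (k - int s0)"
    using best_slack_exists by blast
  have "s0 = 0"
    using best_slack_optimal(1)[OF s0] assms \<open>\<not> S \<ge> 1\<close> unfolding slack_bound_def by fastforce
  let ?x = "\<lambda>t i. int (c i) * ceil_div (t + int (J i)) (int (p i))"
  have mono: "?x (k - 1) i \<le> ?x k i" if "i \<in> {1..<n}" for i
    unfolding ceil_div_def using that task_bounds(2)[of i]
    by (intro mult_left_mono le_imp_neg_le zdiv_mono1) auto
  have split: "{1..<n} = insert 1 {2..<n}" using n_ge_2 by auto
  have "k + int (J 1) = 1" "k - 1 + int (J 1) = 0" unfolding k_def by auto
  moreover have "ceil_div 1 (int (p 1)) = 1"
    unfolding ceil_div_def using p1_ge_2 by (simp add: div_eq_minus1)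
  moreover have "ceil_div 0 (int (p 1)) = 0" unfolding ceil_div_def by simp
  ultimately have "?x (k - 1) 1 + 1 \<le> ?x k 1"
    using task_bounds(1)[of 1] n_ge_2 by (simp only:) simp
  moreover have "(\<Sum>i\<in>{2..<n}. ?x (k - 1) i) \<le> (\<Sum>i\<in>{2..<n}. ?x k i)"
    by (intro sum_mono mono) auto
  \<comment> \<open>The loss of 1 in \<open>t\<close> is made up by a drop of at least 1 in the
    first term of the sum, so slack 1 is optimal too.\<close>
  ultimately have "g k \<le> g (k - 1)"
    unfolding surplus_def split by simp
  moreover have "\<forall>s. g (k - int s) \<le> g k" using s0 \<open>s0 = 0\<close> by simp
  ultimately have "\<forall>s. g (k - int s) \<le> g (k - int 1)" by (auto intro: order_trans)
  from best_slack_optimal(1)[OF this] assms \<open>\<not> S \<ge> 1\<close> show False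
    unfolding slack_bound_def by fastforce
qed

end


section \<open>Evaluating the mixing-set optimum\<close>

abbreviation M0 :: expr where "M0 \<equiv> Mem (Const 0)"
abbreviation M1 :: expr where "M1 \<equiv> Mem (Const 1)"
abbreviation M2 :: expr where "M2 \<equiv> Mem (Const 2)"
abbreviation M3 :: expr where "M3 \<equiv> Mem (Const 3)"
abbreviation M4 :: expr where "M4 \<equiv> Mem (Const 4)"

text \<open>Cells 1 and 2 hold \<open>k\<close> and \<open>s\<close>; cell 3 accumulates the objective, with task index in cell 4.\<close>

definition objective_step :: prog where
  "objective_step =
     Seq (Store (Const 3) (Add M3 (Mul (Inp (Sub (Mul (Const 4) M4) (Const 2)))
            (Sub (Const 0) (Div (Sub M2 (Add M1 (Inp (Add (Mul (Const 4) M4) (Const 1)))))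
                                (Inp (Mul (Const 4) M4)))))))
         (Store (Const 4) (Sub M4 (Const 1)))"

definition objective_prog :: prog where
  "objective_prog =
     Seq (Store (Const 3) M2)
    (Seq (Store (Const 4) (Sub (Inp (Const 0)) (Const 1)))
         (While M4 objective_step))"

text \<open>Cell 0 holds the running minimum. It starts with the value at \<open>s = S\<close>, with
  \<open>S\<close> read from the input, and \<open>s\<close> then counts down to 0.\<close>

definition mix_prog :: prog where
  "mix_prog =
     Seq (Store (Const 1) M0)
    (Seq (Store (Const 2) (Inp (Const 1)))
    (Seq objective_prog
    (Seq (Store (Const 0) M3)
         (While M2
           (Seq (Store (Const 2) (Sub M2 (Const 1)))
           (Seq objective_prog
                (Cond (Sub M0 M3) (Store (Const 0) M3) Skip)))))))"

context tasks
begin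

section \<open>Correctness and cost of the evaluation program\<close>

lemma runs_objective_step:
  assumes "j \<in> {1..<n}" and "m 4 = int j"
  shows "runs (encode n c d p J S) objective_step m 50 (\<lambda>m'. m' = m
           (3 := m 3 + int (c j) * ceil_div (m 1 - m 2 + int (J j)) (int (p j)),
            4 := int j - 1))"
proof -
  have j: "j \<in> {1..n}" using assms(1) by auto
  \<comment> \<open>Input reads are to be rewritten through their address and not unfolded into list
    access.\<close>
  note [simp del] = eval.simps(3)
  note [simp] = eval_Inp_encode[OF j _ refl] eval_Inp_encode_header
  show ?thesis
    unfolding objective_step_def
    apply (rule runs_weaken)
      apply (rule runs_Seq runs_Store)+
    by (auto simp: assms(2) ceil_div_def algebra_simps)
qed

lemma runs_objective_prog:
  "runs (encode n c d p J S) objective_prog m (60 * n) (\<lambda>m'. \<exists>i. m' = m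
     (3 := m 1 - surplus n c p J (m 1 - m 2), 4 := i))"
proof -
  let ?x = "\<lambda>i. int (c i) * ceil_div (m 1 - m 2 + int (J i)) (int (p i))"
  \<comment> \<open>Tasks \<open>Suc j\<close> to \<open>n - 1\<close> have been added already;
    \<open>j\<close> is both the next task and the countdown.\<close>
  define I where "I = (\<lambda>j m'. j < n \<and> m' = m(3 := m 2 + (\<Sum>i\<in>{Suc j..<n}. ?x i), 4 := int j))"
  have loop: "runs (encode n c d p J S) (While M4 objective_step) m' (Suc j * (50 + cost M4 + 1))
      (\<lambda>m'. \<exists>i. m' = m(3 := m 1 - surplus n c p J (m 1 - m 2), 4 := i))" if "I j m'" for j m'
  proof (rule runs_While[of I, OF that])
    fix j m' assume I: "I j m'" and "0 < eval (encode n c d p J S) m' M4"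
    then obtain j' where j': "j = Suc j'" "j \<in> {1..<n}"
      by (cases j) (auto simp: I_def)
    have "{Suc j'..<n} = insert j {Suc j..<n}"
      using j' by auto
    then have "(\<Sum>i\<in>{Suc j'..<n}. ?x i) = ?x j + (\<Sum>i\<in>{Suc j..<n}. ?x i)" by simp
    moreover have "m' 4 = int j" using I by (simp add: I_def)
    ultimately have "runs (encode n c d p J S) objective_step m' 50 (I j')"
      using I j' by (intro runs_mono[OF runs_objective_step[of j m' S]]) (auto simp: I_def)
    with j' show "\<exists>j'. j = Suc j' \<and> runs (encode n c d p J S) objective_step m' 50 (I j')"
      by blast
  next
    fix j m' assume "I j m'" and "\<not> 0 < eval (encode n c d p J S) m' M4"
    then show "\<exists>i. m' = m(3 := m 1 - surplus n c p J (m 1 - m 2), 4 := i)"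
      by (auto simp: I_def surplus_def intro!: exI[of _ 0])
  qed
  note [simp del] = eval.simps(3)
  note [simp] = eval_Inp_encode_header
  show ?thesis
    unfolding objective_prog_def
    apply (rule runs_weaken)
      apply (rule runs_Seq runs_Store)+
      apply (rule loop[of "n - 1"])
    \<comment> \<open>The loop costs \<open>53 * n\<close> and the two stores before it 10, which
      \<open>60 * n\<close> covers because \<open>n \<ge> 2\<close>.\<close>
    using n_ge_2 by (auto simp: I_def of_nat_diff)
qed

lemma runs_mix_prog:
  assumes "slack_bound n c p J S"
  shows "runs (encode n c d p J S) mix_prog (init_mem k) (400 * (S * n)) (\<lambda>m. m 0 = M k)"
proof -
  let ?inp = "encode n c d p J S"
  let ?f = "\<lambda>s. k - g (k - s)"
  let ?body = "Seq (Store (Const 2) (Sub M2 (Const 1)))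
    (Seq objective_prog (Cond (Sub M0 M3) (Store (Const 0) M3) Skip))"
  \<comment> \<open>Cell 0 is the minimum over the slacks from \<open>j\<close> to \<open>S\<close>
    examined so far; the range is never empty.\<close>
  define I where "I = (\<lambda>j (m::mem). m 0 = Min (?f ` {int j..int S}) \<and> m 1 = k \<and> m 2 = int j \<and> j \<le> S)"
  have loop: "runs ?inp (While M2 ?body) m (Suc j * ((60 * n + 20) + cost M2 + 1))
      (\<lambda>m. m 0 = M k)" if "I j m" for j m
  proof (rule runs_While[of I, OF that])
    fix j m assume I: "I j m" and "0 < eval ?inp m M2"
    then obtain j' where j': "j = Suc j'"
      by (cases j) (auto simp: I_def)
    have "{int j'..int S} = insert (int j') {int j..int S}"
      using j' I by (auto simp: I_def)
    moreover have "{int j..int S} \<noteq> {}" using I by (auto simp: I_def)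
    ultimately have "Min (?f ` {int j'..int S}) = min (?f (int j')) (Min (?f ` {int j..int S}))"
      by (simp only: image_insert) (subst Min_insert, auto)
    with I have m: "Min (?f ` {int j'..int S}) = min (?f (int j')) (m 0)"
        "m 1 = k" "m 2 = int j" "j \<le> S"
      by (simp_all only: I_def)
    have "runs ?inp ?body m (60 * n + 20) (I j')"
      apply (rule runs_weaken)
        apply (rule runs_Seq runs_Store)+
        apply (rule runs_mono[OF runs_objective_prog order_refl])
        apply (erule exE)
        apply (rule runs_Cond)
         apply (rule runs_Store)
         prefer 2 apply (rule runs_Skip)
      using m j' by (auto simp: I_def)
    with j' show "\<exists>j'. j = Suc j' \<and> runs ?inp ?body m (60 * n + 20) (I j')"
      by blast
  next
    fix j m assume "I j m" and "\<not> 0 < eval ?inp m M2"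
    then show "m 0 = M k"
      using mix_min_eq_Min[OF assms] by (simp add: I_def)
  qed
  have S: "S \<ge> 1" using slack_bound_pos assms by blast
  then have Sn: "n \<le> S * n" "2 \<le> S * n" "S \<le> S * n"
    using n_ge_2 by (auto simp: mult_le_mono[of 1 S 2 n, simplified])
  \<comment> \<open>These are the lower-order terms beside \<open>60 * (S * n)\<close>; positivity
    of \<open>S\<close> is what lets \<open>S * n\<close> absorb those in \<open>n\<close>
    alone.\<close>
  then have time: "35 + (S * 23 + n * 120) \<le> 340 * (S * n)" by linarith
  note [simp del] = eval.simps(3)
  note [simp] = eval_Inp_encode_header
  show ?thesis
    unfolding mix_prog_def
    apply (rule runs_weaken)
      apply (rule runs_Seq runs_Store)+
      apply (rule runs_mono[OF runs_objective_prog order_refl])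
      apply (erule exE)
      apply (rule runs_Seq runs_Store)+
      apply (rule loop[of S])
    using time by (auto simp: I_def init_mem_def algebra_simps)
qed

end


section \<open>Computing the response time by bisection\<close>

text \<open>For \<open>e = k - M k\<close> the value is positive exactly if \<open>k\<close> lies
  below the response time, which makes it usable as a test.\<close>

definition cn_minus :: "expr \<Rightarrow> expr" where
  "cn_minus e = Sub (Inp (Sub (Mul (Const 4) (Inp (Const 0))) (Const 2))) e"

lemma cost_cn_minus: "cost (cn_minus e) = cost e + 8"
  unfolding cn_minus_def by simp

text \<open>Cells 0 and 1 hold the ends of the bisection interval, cell 3 its midpoint, and cell 2 the
  value of \<open>M\<close>.\<close>

definition doubling_body :: "prog \<Rightarrow> prog" where
  "doubling_body P = Seq (Store (Const 1) (Add M1 M1)) (Call (Const 2) P M1)"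

definition bisection_body :: "prog \<Rightarrow> prog" where
  "bisection_body P =
     Seq (Store (Const 3) (Div (Add M0 M1) (Const 2)))
    (Seq (Call (Const 2) P M3)
         (Cond (cn_minus (Sub M3 M2)) (Store (Const 0) M3) (Store (Const 1) M3)))"

text \<open>Doubling starts at 1 and leaves cell 0 untouched, so bisection starts with lower end
  0.\<close>

definition response_prog :: "prog \<Rightarrow> prog" where
  "response_prog P =
     Seq (Store (Const 1) (Const 1))
    (Seq (Call (Const 2) P M1)
    (Seq (While (cn_minus (Sub M1 M2)) (doubling_body P))
    (Seq (While (Sub (Sub M1 M0) (Const 1)) (bisection_body P))
         (Store (Const 0) M1))))"

context tasks
begin

abbreviation R :: int where "R \<equiv> int (response_time n c p J)"

section \<open>Correctness and cost of the search\<close>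

lemma eval_cn_minus:
  "eval (encode n c d p J S) m (cn_minus e) = int (c n) - eval (encode n c d p J S) m e"
proof -
  have "n \<in> {1..n}" using n_ge_2 by auto
  note eval_Inp_encode(1)[OF this _ refl, of c d p J S m
      "Sub (Mul (Const 4) (Inp (Const 0))) (Const 2)"]
  moreover have "eval (encode n c d p J S) m (Sub (Mul (Const 4) (Inp (Const 0))) (Const 2)) = 4 * int n - 2"
    using eval_Inp_encode_header(1) by (metis eval.simps(1,5,6))
  ultimately show ?thesis unfolding cn_minus_def by (metis eval.simps(5))
qed

lemma response_time_pos: "R > 0"
  using response_time_le_iff[of 0] surplus_less by force

lemma runs_response_prog:
  assumes P: "\<And>k. runs (encode n c d p J S) P (init_mem k) \<tau> (\<lambda>m. m 0 = M k)"
    and L: "R \<le> 2 ^ L"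
  shows "runs (encode n c d p J S) (response_prog P) (init_mem 0) (2 * (L + 2) * (\<tau> + 50))
           (\<lambda>m. m 0 = R)"
proof -
  let ?inp = "encode n c d p J S"
  note iff = response_time_le_iff_mix_min
  note [simp] = eval_cn_minus
  \<comment> \<open>Here \<open>j\<close> counts the doublings left before cell 1 reaches
    \<open>2 ^ L\<close>. In \<open>K\<close> below, \<open>R\<close> lies in the half-open interval
    from cell 0, excluded, to cell 1, included, whose length is at most
    \<open>2 ^ j\<close>.\<close>
  define I where "I = (\<lambda>j (m::mem). m 0 = 0 \<and> m 1 * 2 ^ j = 2 ^ L \<and> m 2 = M (m 1))"
  define K where "K = (\<lambda>j (m::mem). m 0 < R \<and> R \<le> m 1 \<and> m 1 - m 0 \<le> 2 ^ j)"
  have doubling: "runs ?inp (While (cn_minus (Sub M1 M2)) (doubling_body P)) m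
      (Suc j * ((\<tau> + 20) + cost (cn_minus (Sub M1 M2)) + 1)) (K L)" if "I j m" for j m
  proof (rule runs_While[of I, OF that])
    fix j m assume I: "I j m" and "0 < eval ?inp m (cn_minus (Sub M1 M2))"
    then have less: "m 1 < R" using iff[of "m 1"] by (auto simp: I_def)
    \<comment> \<open>For \<open>j = 0\<close> cell 1 would equal \<open>2 ^ L \<ge> R\<close>,
      contradicting the successful test.\<close>
    obtain j' where j': "j = Suc j'"
      using I L less by (cases j) (auto simp: I_def)
    have "runs ?inp (doubling_body P) m (\<tau> + 20) (I j')"
      unfolding doubling_body_def
      apply (rule runs_weaken)
        apply (rule runs_Seq runs_Store)+
        apply (rule runs_Call[OF P])
      using I j' by (auto simp: I_def)
    with j' show "\<exists>j'. j = Suc j' \<and> runs ?inp (doubling_body P) m (\<tau> + 20) (I j')"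
      by blast
  next
    fix j m assume I: "I j m" and "\<not> 0 < eval ?inp m (cn_minus (Sub M1 M2))"
    then have le: "R \<le> m 1" using iff[of "m 1"] by (auto simp: I_def)
    then have "m 1 * 1 \<le> m 1 * 2 ^ j"
      using response_time_pos by (intro mult_left_mono) auto
    with I le show "K L m" using response_time_pos by (auto simp: I_def K_def)
  qed
  have bisection: "runs ?inp (While (Sub (Sub M1 M0) (Const 1)) (bisection_body P)) m
      (Suc j * ((\<tau> + 35) + cost (Sub (Sub M1 M0) (Const 1)) + 1)) (\<lambda>m. m 1 = R)"
    if "K j m" for j m
  proof (rule runs_While[of K, OF that])
    fix j m assume K: "K j m" and "0 < eval ?inp m (Sub (Sub M1 M0) (Const 1))"
    then obtain j' where j': "j = Suc j'" by (cases j) (auto simp: K_def)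
    \<comment> \<open>The gap is at least 2, so the floored midpoint lies strictly inside, and both
      halves have length at most \<open>2 ^ j'\<close> despite the rounding.\<close>
    have "runs ?inp (bisection_body P) m (\<tau> + 35) (K j')"
      unfolding bisection_body_def
      apply (rule runs_weaken)
        apply (rule runs_Seq runs_Store runs_Call[OF P])+
        apply (rule runs_Cond)
         apply (rule runs_Store)
         prefer 2 apply (rule runs_Store)
      using K j' iff[of "(m 0 + m 1) div 2"] by (auto simp: K_def cost_cn_minus)
    with j' show "\<exists>j'. j = Suc j' \<and> runs ?inp (bisection_body P) m (\<tau> + 35) (K j')"
      by blast
  next
    fix j m assume "K j m" and "\<not> 0 < eval ?inp m (Sub (Sub M1 M0) (Const 1))"
    then show "m 1 = R" by (auto simp: K_def)
  qed
  show ?thesis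
    unfolding response_prog_def
    apply (rule runs_weaken)
      apply (rule runs_Seq runs_Store runs_Call[OF P])+
      apply (rule runs_mono[OF doubling[of L] order_refl])
       prefer 2
       apply (rule runs_Seq)
       apply (rule runs_mono[OF bisection order_refl])
        apply assumption
       apply (rule runs_Store)
    by (auto simp: I_def init_mem_def cost_cn_minus algebra_simps)
qed

section \<open>Logarithmic number of iterations and total time\<close>

lemma response_time_le_power:
  "\<exists>L. R \<le> 2 ^ L \<and> real L \<le> 5 * log 2 (real (p_max n p))"
proof -
  let ?l = "log 2 (real (p_max n p))"
  \<comment> \<open>Weakening \<open>3 * p_max\<^sup>2\<close> to \<open>4 * p_max\<^sup>2\<close>
    gives the exact power \<open>2 powr (2 + 2 * ?l)\<close>. Rounding up adds at most 1, and
    \<open>3 + 2 * ?l \<le> 5 * ?l\<close> as \<open>?l \<ge> 1\<close>.\<close>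
  define L where "L = nat \<lceil>2 + 2 * ?l\<rceil>"
  have "real (4 * (p_max n p)\<^sup>2) = 2 powr (2 + 2 * ?l)"
  proof -
    have "2 powr (2 * ?l) = (2 powr ?l) powr 2" by (simp add: powr_powr mult.commute)
    also have "\<dots> = (real (p_max n p))\<^sup>2" using p_max_ge_2 by simp
    finally show ?thesis by (simp add: powr_add)
  qed
  also have "\<dots> \<le> 2 powr (real L)"
    unfolding L_def by (intro powr_mono) linarith+
  also have "\<dots> = real (2 ^ L)" by (simp add: powr_realpow)
  finally have "4 * (p_max n p)\<^sup>2 \<le> 2 ^ L" by linarith
  with response_time_le have "response_time n c p J \<le> 2 ^ L" by linarith
  then have "R \<le> 2 ^ L" by (metis of_nat_le_iff of_nat_numeral of_nat_power)
  moreover have "real L \<le> 5 * ?l" unfolding L_def using log_p_max_ge_1 by linarith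
  ultimately show ?thesis by blast
qed

lemma computes_response_time_response_prog:
  assumes "computes_mix_min T P n c d p J S"
  shows "computes_response_time (1000 * (T * log 2 (real (p_max n p))))
      (response_prog P) n c d p J S"
proof -
  let ?l = "log 2 (real (p_max n p))"
  have P: "computes_within T P (encode n c d p J S) k (M k)" for k
    using assms unfolding computes_mix_min_def by blast
  from P[of 0] obtain t m where "exec (encode n c d p J S) P (init_mem 0) t m" "real t \<le> T"
    unfolding computes_within_def by blast
  with exec_time_pos have T: "T \<ge> 1" by fastforce
  obtain L where L: "R \<le> 2 ^ L" "real L \<le> 5 * ?l"
    using response_time_le_power by blast
  have \<tau>: "real (nat \<lfloor>T\<rfloor>) \<le> T" using T by linarith
  have "real (2 * (L + 2) * (nat \<lfloor>T\<rfloor> + 50)) = 2 * (real L + 2) * (real (nat \<lfloor>T\<rfloor>) + 50)"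
    by (simp add: algebra_simps)
  \<comment> \<open>The factors are \<open>14 = 2 * (5 + 2)\<close> and \<open>51 = 1 + 50\<close>,
    using \<open>?l \<ge> 1\<close> and \<open>T \<ge> 1\<close>.\<close>
  also have "\<dots> \<le> (14 * ?l) * (51 * T)"
  proof (rule mult_mono)
    show "2 * (real L + 2) \<le> 14 * ?l" using L(2) log_p_max_ge_1 by simp
    show "real (nat \<lfloor>T\<rfloor>) + 50 \<le> 51 * T" using \<tau> T by argo
  qed (use log_p_max_ge_1 in auto)
  also have "\<dots> \<le> 1000 * (T * ?l)" using T log_p_max_ge_1 by simp
  finally show "computes_response_time (1000 * (T * ?l)) (response_prog P) n c d p J S"
    unfolding computes_response_time_def
    by (intro computes_within_runsI[OF runs_response_prog[OF _ L(1)]])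
      (use P computes_within_iff_runs in blast)
qed

lemma computes_mix_min_mix_prog:
  assumes "slack_bound n c p J S"
  shows "computes_mix_min (400 * real (S * n)) mix_prog n c d p J S"
  unfolding computes_mix_min_def
  by (intro allI computes_within_runsI[OF runs_mix_prog[OF assms]]) simp

end

lemma computes_response_time_mono:
  "computes_response_time T P n c d p J S \<Longrightarrow> T \<le> T' \<Longrightarrow> computes_response_time T' P n c d p J S"
  unfolding computes_response_time_def computes_within_def by (meson order_trans)

theorem theorem19:
  "(\<exists>C::real. \<forall>P\<^sub>M. \<exists>P\<^sub>r. \<forall>n c d p J S (T::real).
      task_system n c d p J \<and> slack_bound n c p J S \<and> computes_mix_min T P\<^sub>M n c d p J S \<longrightarrow>
      computes_response_time
        (C * max (real (S * n)) (T * log 2 (real (p_max n p)))) P\<^sub>r n c d p J S)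
   \<and> (\<exists>(C::real) P\<^sub>M. \<forall>n c d p J S.
      task_system n c d p J \<and> slack_bound n c p J S \<longrightarrow>
      (\<exists>T::real. computes_mix_min T P\<^sub>M n c d p J S \<and>
        max (real (S * n)) (T * log 2 (real (p_max n p)))
          \<le> C * (real (S * n) * log 2 (real (p_max n p)))))
   \<and> (\<exists>(C::real) P\<^sub>r. \<forall>n c d p J S.
      task_system n c d p J \<and> slack_bound n c p J S \<longrightarrow>
      computes_response_time
        (C * (real (S * n) * log 2 (real (p_max n p)))) P\<^sub>r n c d p J S)"
proof (intro conjI)
  show "\<exists>C::real. \<forall>P\<^sub>M. \<exists>P\<^sub>r. \<forall>n c d p J S (T::real).
      task_system n c d p J \<and> slack_bound n c p J S \<and> computes_mix_min T P\<^sub>M n c d p J S \<longrightarrow>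
      computes_response_time
        (C * max (real (S * n)) (T * log 2 (real (p_max n p)))) P\<^sub>r n c d p J S"
  proof (intro exI[of _ 1000] allI exI[of _ "response_prog _"] impI, elim conjE)
    fix P n c d p J S and T :: real
    assume "task_system n c d p J" and T: "computes_mix_min T P n c d p J S"
    then interpret tasks n c d p J by unfold_locales
    show "computes_response_time
        (1000 * max (real (S * n)) (T * log 2 (real (p_max n p)))) (response_prog P) n c d p J S"
      by (rule computes_response_time_mono[OF computes_response_time_response_prog[OF T]]) simp
  qed
next
  show "\<exists>(C::real) P\<^sub>M. \<forall>n c d p J S.
      task_system n c d p J \<and> slack_bound n c p J S \<longrightarrow>
      (\<exists>T::real. computes_mix_min T P\<^sub>M n c d p J S \<and>
        max (real (S * n)) (T * log 2 (real (p_max n p)))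
          \<le> C * (real (S * n) * log 2 (real (p_max n p))))"
  proof (rule exI[of _ 400], rule exI[of _ mix_prog], intro allI impI, elim conjE)
    fix n c d p J S
    assume "task_system n c d p J" and S: "slack_bound n c p J S"
    then interpret tasks n c d p J by unfold_locales
    \<comment> \<open>The logarithm is at least 1, so \<open>S * n\<close> is dominated as
      well.\<close>
    have "real (S * n) * 1 \<le> real (S * n) * log 2 (real (p_max n p))"
      using log_p_max_ge_1 by (intro mult_left_mono) auto
    moreover have "0 \<le> real (S * n)" by simp
    ultimately have "max (real (S * n)) (400 * real (S * n) * log 2 (real (p_max n p)))
        \<le> 400 * (real (S * n) * log 2 (real (p_max n p)))" by linarith
    with computes_mix_min_mix_prog[OF S] show "\<exists>T::real. computes_mix_min T mix_prog n c d p J S \<and>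
        max (real (S * n)) (T * log 2 (real (p_max n p)))
          \<le> 400 * (real (S * n) * log 2 (real (p_max n p)))" by blast
  qed
next
  show "\<exists>(C::real) P\<^sub>r. \<forall>n c d p J S.
      task_system n c d p J \<and> slack_bound n c p J S \<longrightarrow>
      computes_response_time
        (C * (real (S * n) * log 2 (real (p_max n p)))) P\<^sub>r n c d p J S"
  \<comment> \<open>The constant is the product of 1000 for the search and 400 for each evaluation
    of \<open>M\<close> by \<open>mix_prog\<close>.\<close>
  proof (intro exI[of _ 400000] exI[of _ "response_prog mix_prog"] allI impI, elim conjE)
    fix n c d p J S
    assume "task_system n c d p J" and S: "slack_bound n c p J S"
    then interpret tasks n c d p J by unfold_locales
    show "computes_response_time (400000 * (real (S * n) * log 2 (real (p_max n p))))
        (response_prog mix_prog) n c d p J S"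
      by (rule computes_response_time_mono
          [OF computes_response_time_response_prog[OF computes_mix_min_mix_prog[OF S]]]) simp
  qed
qed

end
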